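(* Let $(V,V^+)$ be an ordered $*$-vector space with Archimedean order unit $e$, and assume $V\neq\{0\}$. Then the minimal order norm $\|\cdot\|_m$ and the maximal order norm $\|\cdot\|_M$ on $V$ are equal if and only if $V$ is isomorphic (via a unital order isomorphism) to the complex numbers $\mathbb{C}$.
   Context: A $*$-vector space is a complex vector space $V$ with a conjugate-linear involution $*:V\to V$; $V_h:=\{x\in V: x^*=x\}$. An ordered $*$-vector space $(V,V^+)$ is a $*$-vector space $V$ with a nonempty subset $V^+\subseteq V_h$ closed under addition and under multiplication by scalars in $[0,\infty)$, such that $V^+\cap -V^+=\{0\}$. For $v,w\in V_h$ write $v\ge w$ if $v-w\in V^+$. An element $e\in V_h$ is an order unit if for every $x\in V_h$ there is a real $r>0$ with $re\ge x$; it is Archimedean if, in addition, whenever $x\in V_h$ and $re+x\ge0$ for all real $r>0$, then $x\ge 0$. A state on $V$ is a $\mathbb{C}$-linear functional $f:V\to\mathbb{C}$ with $f(V^+)\subseteq[0,\infty)$ and $f(e)=1$. A unital order isomorphism is a $\mathbb{C}$-linear bijection $\phi$ taking order unit to order unit with $v$ positive if and only if $\phi(v)$ positive. The order norm on $V_h$ is $\|v\|:=\inf\{r\in\mathbb{R}: re+v\ge0\text{ and }re-v\ge0\}$. The minimal order norm on $V$ is $\|v\|_m := \sup \{ |f(v)|: f:V \to \mathbb{C} \text{ is a state} \}$. The maximal order norm on $V$ is $\|v\|_M := \inf \{ \sum_{i=1}^n |\lambda_i| \, \|v_i\| : v = \sum_{i=1}^n \lambda_i v_i,\ v_i \in V_h,\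 \lambda_i \in \mathbb{C} \}$. $\mathbb{C}$ is regarded as an ordered $*$-vector space with involution complex conjugation, positive cone $[0,\infty)$, and Archimedean order unit $1$. *)

theory Defs
  imports "HOL-Analysis.Analysis" "HOL-Library.Nonpos_Ints"
begin

locale star_vector_space = vector_space scale
  for scale :: "complex \<Rightarrow> 'a::ab_group_add \<Rightarrow> 'a" +
  fixes star :: "'a \<Rightarrow> 'a"
  assumes star_add: "star (x + y) = star x + star y"
    and star_scale: "star (scale c x) = scale (cnj c) (star x)"
    and star_star: "star (star x) = x"
begin

definition hermitian :: "'a set"
  where "hermitian = {x. star x = x}"

end

locale ordered_star_vector_space = star_vector_space scale star
  for scale :: "complex \<Rightarrow> 'a::ab_group_add \<Rightarrow> 'a" and star :: "'a \<Rightarrow> 'a" +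
  fixes pos :: "'a set"
  assumes pos_nonempty: "pos \<noteq> {}"
    and pos_hermitian: "pos \<subseteq> hermitian"
    and pos_add: "x \<in> pos \<Longrightarrow> y \<in> pos \<Longrightarrow> x + y \<in> pos"
    and pos_scale: "0 \<le> r \<Longrightarrow> x \<in> pos \<Longrightarrow> scale (complex_of_real r) x \<in> pos"
    and pos_proper: "pos \<inter> uminus ` pos = {0}"
begin

definition le :: "'a \<Rightarrow> 'a \<Rightarrow> bool"
  where "le w v \<longleftrightarrow> w \<in> hermitian \<and> v \<in> hermitian \<and> v - w \<in> pos"

definition order_unit :: "'a \<Rightarrow> bool"
  where "order_unit u \<longleftrightarrow> u \<in> hermitian \<and>
    (\<forall>x\<in>hermitian. \<exists>r>0. le x (scale (complex_of_real r) u))"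

definition archimedean_order_unit :: "'a \<Rightarrow> bool"
  where "archimedean_order_unit u \<longleftrightarrow> order_unit u \<and>
    (\<forall>x\<in>hermitian. (\<forall>r>0. le 0 (scale (complex_of_real r) u + x)) \<longrightarrow> le 0 x)"

end

locale archimedean_ordered_star_vector_space = ordered_star_vector_space scale star pos
  for scale :: "complex \<Rightarrow> 'a::ab_group_add \<Rightarrow> 'a" and star :: "'a \<Rightarrow> 'a" and pos :: "'a set" +
  fixes e :: 'a
  assumes archimedean_unit: "archimedean_order_unit e"
begin

definition state :: "('a \<Rightarrow> complex) \<Rightarrow> bool"
  where "state f \<longleftrightarrow> Vector_Spaces.linear scale (*) f \<and> f ` pos \<subseteq> \<real>\<^sub>\<ge>\<^sub>0 \<and> f e = 1"

(* Meaningful only for hermitian v. *)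
definition order_norm :: "'a \<Rightarrow> real"
  where "order_norm v = Inf {r::real. le 0 (scale (complex_of_real r) e + v) \<and>
    le 0 (scale (complex_of_real r) e - v)}"

(* In a nonzero space, the sets below and the one above (for hermitian v) are nonempty and
   bounded on the relevant side, so the real Sup and Inf are the usual ones. *)
definition min_order_norm :: "'a \<Rightarrow> real"
  where "min_order_norm v = Sup {cmod (f v) | f. state f}"

definition max_order_norm :: "'a \<Rightarrow> real"
  where "max_order_norm v = Inf {\<Sum>i=1..n. cmod (l i) * order_norm (w i)
    | (n::nat) (l :: nat \<Rightarrow> complex) (w :: nat \<Rightarrow> 'a).
      (\<forall>i\<in>{1..n}. w i \<in> hermitian) \<and> v = (\<Sum>i=1..n. scale (l i) (w i))}"

end

definition unital_order_isomorphism ::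
  "(complex \<Rightarrow> 'a::ab_group_add \<Rightarrow> 'a) \<Rightarrow> 'a set \<Rightarrow> 'a \<Rightarrow>
   (complex \<Rightarrow> 'b::ab_group_add \<Rightarrow> 'b) \<Rightarrow> 'b set \<Rightarrow> 'b \<Rightarrow> ('a \<Rightarrow> 'b) \<Rightarrow> bool"
  where "unital_order_isomorphism scale1 pos1 e1 scale2 pos2 e2 \<phi> \<longleftrightarrow>
    Vector_Spaces.linear scale1 scale2 \<phi> \<and> bij \<phi> \<and> \<phi> e1 = e2 \<and>
    (\<forall>v. v \<in> pos1 \<longleftrightarrow> \<phi> v \<in> pos2)"

interpretation complex_star: star_vector_space "(*)" cnj
  by unfold_locales (auto simp: algebra_simps)

lemma complex_star_hermitian: "complex_star.hermitian = \<real>"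
  by (auto simp: complex_star.hermitian_def Reals_cnj_iff)

interpretation complex_ordered: ordered_star_vector_space "(*)" cnj "\<real>\<^sub>\<ge>\<^sub>0"
proof unfold_locales
  show "(\<real>\<^sub>\<ge>\<^sub>0 :: complex set) \<inter> uminus ` \<real>\<^sub>\<ge>\<^sub>0 = {0}"
  proof (intro equalityI subsetI)
    fix z :: complex assume "z \<in> \<real>\<^sub>\<ge>\<^sub>0 \<inter> uminus ` \<real>\<^sub>\<ge>\<^sub>0"
    then obtain w where "z \<in> \<real>\<^sub>\<ge>\<^sub>0" "w \<in> \<real>\<^sub>\<ge>\<^sub>0" "z = - w" by blast
    then show "z \<in> {0}" by (simp add: complex_nonneg_Reals_iff complex_eq_iff)
  next
    fix z :: complex assume "z \<in> {0}"
    then have "z \<in> \<real>\<^sub>\<ge>\<^sub>0" "z = - z" by simp_all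
    then show "z \<in> \<real>\<^sub>\<ge>\<^sub>0 \<inter> uminus ` \<real>\<^sub>\<ge>\<^sub>0" by blast
  qed
  show "(\<real>\<^sub>\<ge>\<^sub>0 :: complex set) \<noteq> {}"
    using nonneg_Reals_zero_I by blast
  show "(\<real>\<^sub>\<ge>\<^sub>0 :: complex set) \<subseteq> complex_star.hermitian"
    unfolding complex_star_hermitian by (rule nonneg_Reals_subset_Reals)
  show "x + y \<in> \<real>\<^sub>\<ge>\<^sub>0" if "x \<in> \<real>\<^sub>\<ge>\<^sub>0" "y \<in> \<real>\<^sub>\<ge>\<^sub>0" for x y :: complex
    using that by (rule nonneg_Reals_add_I)
  show "complex_of_real r * x \<in> \<real>\<^sub>\<ge>\<^sub>0" if "0 \<le> r" "x \<in> \<real>\<^sub>\<ge>\<^sub>0" for r x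
    using that by (intro nonneg_Reals_mult_I) simp_all
qed

interpretation complex_archimedean:
  archimedean_ordered_star_vector_space "(*)" cnj "\<real>\<^sub>\<ge>\<^sub>0" 1
proof unfold_locales
  have le: "complex_ordered.le w v \<longleftrightarrow> w \<in> \<real> \<and> v \<in> \<real> \<and> Re w \<le> Re v" for w v
    unfolding complex_ordered.le_def complex_star_hermitian complex_nonneg_Reals_iff
      complex_is_Real_iff by auto
  show "complex_ordered.archimedean_order_unit 1"
    unfolding complex_ordered.archimedean_order_unit_def complex_ordered.order_unit_def
      complex_star_hermitian le
  proof (intro conjI ballI impI)
    fix x :: complex assume x: "x \<in> \<real>"
    show "\<exists>r>0. x \<in> \<real> \<and> complex_of_real r * 1 \<in> \<real> \<and> Re x \<le> Re (complex_of_real r * 1)"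
      by (rule exI[of _ "max 1 (Re x)"]) (simp add: x)
  next
    fix x :: complex
    assume *: "\<forall>r>0. 0 \<in> \<real> \<and> complex_of_real r * 1 + x \<in> \<real> \<and>
      Re 0 \<le> Re (complex_of_real r * 1 + x)"
    have "0 \<le> Re x + r" if "r > 0" for r
      using *[rule_format, OF that] by simp
    then show "Re 0 \<le> Re x"
      unfolding zero_complex.sel by (rule field_le_epsilon)
  qed simp_all
qed

end

theory Submission
  imports Defs
begin

text \<open>
  Let \<open>\<phi>\<close> be a unital order isomorphism onto \<open>\<complex>\<close>. Then \<open>v = (\<phi> v) e\<close> for all \<open>v\<close>, so
  \<open>\<phi>\<close> is the only state and the minimal norm is \<open>v \<mapsto> \<bar>\<phi> v\<bar>\<close>. The maximal norm is at most
  that, by the decomposition \<open>v = (\<phi> v) e\<close>, and at least that, because \<open>\<bar>\<phi> w\<bar> \<le> \<parallel>w\<parallel>\<close> for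
  hermitian \<open>w\<close>.

  For the converse it suffices that equality of the norms makes every hermitian element a real
  multiple of \<open>e\<close>, since then \<open>V = \<complex> e\<close>. Suppose that some hermitian \<open>x\<close> is not. By the
  Archimedean property there are a largest \<open>a\<close> and a smallest \<open>b\<close> with \<open>a e \<le> x \<le> b e\<close>
  (lemma \<open>upper_bound_threshold\<close>), and \<open>a < b\<close>. Put \<open>m = (a + b)/2\<close>, \<open>h = (b - a)/2\<close>,
  \<open>y = x - m e\<close> and \<open>v = y + \<i> h e\<close>.

  Since \<open>- h e \<le> y \<le> h e\<close>, a state \<open>f\<close> satisfies \<open>\<bar>f y\<bar> \<le> h\<close>, hence
  \<open>\<bar>f v\<bar> \<le> \<surd>2 h\<close>; so the minimal norm of \<open>v\<close> is at most \<open>\<surd>2 h\<close>. On the other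
  hand, if \<open>v = \<Sum> l\<^sub>i w\<^sub>i\<close> with hermitian \<open>w\<^sub>i\<close>, then
  \<open>x - a e = h e + y = \<Sum> (Im l\<^sub>i + Re l\<^sub>i) w\<^sub>i\<close> and
  \<open>b e - x = h e - y = \<Sum> (Im l\<^sub>i - Re l\<^sub>i) w\<^sub>i\<close>. By the choice of \<open>a\<close> and \<open>b\<close> neither
  of these elements is below \<open>r e\<close> for any \<open>r < 2 h\<close>, so
  \<open>4 h \<le> \<Sum> (\<bar>Im l\<^sub>i + Re l\<^sub>i\<bar> + \<bar>Im l\<^sub>i - Re l\<^sub>i\<bar>) \<parallel>w\<^sub>i\<parallel> \<le> 2 \<Sum> \<bar>l\<^sub>i\<bar> \<parallel>w\<^sub>i\<parallel>\<close>,
  and the maximal norm of \<open>v\<close> is at least \<open>2 h > \<surd>2 h\<close>.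

  No extension theorem for positive functionals is needed: if there were no states, the minimal
  norm would be a constant function, whereas the maximal norm vanishes at \<open>0\<close> and not at \<open>v\<close>.
\<close>

section \<open>Hermitian elements and the cone\<close>

context star_vector_space
begin

lemma star_zero: "star 0 = 0"
  using star_add[of 0 0] by simp

lemma star_minus: "star (- x) = - star x"
  using star_scale[of "-1" x] by simp

lemma star_diff: "star (x - y) = star x - star y"
  using star_add[of x "- y"] by (simp add: star_minus)

lemma star_sum: "star (\<Sum>i\<in>A. g i) = (\<Sum>i\<in>A. star (g i))"
  by (induction A rule: infinite_finite_induct) (auto simp: star_zero star_add)

lemma hermitian_add: "x \<in> hermitian \<Longrightarrow> y \<in> hermitian \<Longrightarrow> x + y \<in> hermitian"
  by (simp add: hermitian_def star_add)

lemma hermitian_diff: "x \<in> hermitian \<Longrightarrow> y \<in> hermitian \<Longrightarrow> x - y \<in> hermitian"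
  by (simp add: hermitian_def star_diff)

lemma hermitian_minus: "x \<in> hermitian \<Longrightarrow> - x \<in> hermitian"
  by (simp add: hermitian_def star_minus)

lemma hermitian_zero: "0 \<in> hermitian"
  by (simp add: hermitian_def star_zero)

lemma hermitian_scale_real:
  "x \<in> hermitian \<Longrightarrow> scale (complex_of_real r) x \<in> hermitian"
  by (simp add: hermitian_def star_scale)

lemma hermitian_sum: "(\<And>i. i \<in> A \<Longrightarrow> g i \<in> hermitian) \<Longrightarrow> (\<Sum>i\<in>A. g i) \<in> hermitian"
  by (simp add: hermitian_def star_sum)

lemma hermitian_parts:
  obtains y z where "y \<in> hermitian" "z \<in> hermitian" "v = y + scale \<i> z"
proof
  let ?y = "scale (1/2) (v + star v)" and ?z = "scale (- \<i>/2) (v - star v)"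
  show "?y \<in> hermitian"
    by (simp add: hermitian_def star_scale star_add star_star add.commute)
  have "star ?z = scale (\<i>/2) (star v - v)"
    by (simp add: star_minus star_scale star_diff star_star)
  also have "\<dots> = ?z"
    by (simp add: scale_right_diff_distrib)
  finally show "?z \<in> hermitian"
    by (simp add: hermitian_def)
  have "?y + scale \<i> ?z = scale (1/2) v + scale (1/2) v"
    by (simp add: scale_right_distrib scale_right_diff_distrib)
  also have "\<dots> = v"
    by (simp flip: scale_left_distrib)
  finally show "v = ?y + scale \<i> ?z" ..
qed

lemma hermitian_parts_unique:
  assumes "y \<in> hermitian" "z \<in> hermitian" "y' \<in> hermitian" "z' \<in> hermitian"
    and eq: "y + scale \<i> z = y' + scale \<i> z'"
  shows "y = y'" "z = z'"
proof -
  have "star (y + scale \<i> z) = star (y' + scale \<i> z')"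
    using eq by simp
  then have eq': "y - scale \<i> z = y' - scale \<i> z'"
    using assms(1-4) by (simp add: hermitian_def star_add star_scale)
  have "scale 2 y = (y + scale \<i> z) + (y - scale \<i> z)"
    using scale_left_distrib[of 1 1 y] by simp
  also have "\<dots> = (y' + scale \<i> z') + (y' - scale \<i> z')"
    unfolding eq eq' ..
  also have "\<dots> = scale 2 y'"
    using scale_left_distrib[of 1 1 y'] by simp
  finally show "y = y'"
    by simp
  with eq show "z = z'"
    by simp
qed

lemma hermitian_parts_sum:
  assumes "y \<in> hermitian" "z \<in> hermitian" "\<And>i. i \<in> A \<Longrightarrow> w i \<in> hermitian"
    and v: "y + scale \<i> z = (\<Sum>i\<in>A. scale (l i) (w i))"
  shows "y = (\<Sum>i\<in>A. scale (complex_of_real (Re (l i))) (w i))"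
    and "z = (\<Sum>i\<in>A. scale (complex_of_real (Im (l i))) (w i))"
proof -
  let ?y = "\<Sum>i\<in>A. scale (complex_of_real (Re (l i))) (w i)"
  let ?z = "\<Sum>i\<in>A. scale (complex_of_real (Im (l i))) (w i)"
  have "scale (l i) (w i) = scale (complex_of_real (Re (l i))) (w i)
      + scale \<i> (scale (complex_of_real (Im (l i))) (w i))" for i
    by (simp flip: scale_left_distrib complex_eq)
  then have "y + scale \<i> z = ?y + scale \<i> ?z"
    unfolding v by (simp add: sum.distrib scale_sum_right)
  moreover have "?y \<in> hermitian" "?z \<in> hermitian"
    using assms(3) by (auto intro!: hermitian_sum hermitian_scale_real)
  ultimately show "y = ?y" "z = ?z"
    using hermitian_parts_unique assms(1,2) by blast+
qed

end

context ordered_star_vector_space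
begin

lemma zero_in_pos: "0 \<in> pos"
  using pos_proper by blast

lemma pos_minus_imp_zero: "x \<in> pos \<Longrightarrow> - x \<in> pos \<Longrightarrow> x = 0"
  using pos_proper by (metis IntI image_eqI minus_minus singletonD)

lemma pos_sum: "(\<And>i. i \<in> A \<Longrightarrow> g i \<in> pos) \<Longrightarrow> (\<Sum>i\<in>A. g i) \<in> pos"
  by (induction A rule: infinite_finite_induct) (auto simp: zero_in_pos pos_add)

end

section \<open>The order unit and the order norm\<close>

context archimedean_ordered_star_vector_space
begin

lemma unit_hermitian: "e \<in> hermitian"
  using archimedean_unit by (simp add: archimedean_order_unit_def order_unit_def)

lemma unit_bounds:
  assumes "x \<in> hermitian"
  obtains r where "0 < r" "scale (complex_of_real r) e - x \<in> pos"
  using archimedean_unit assms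
  unfolding archimedean_order_unit_def order_unit_def le_def by blast

lemma archimedean:
  assumes "x \<in> hermitian" "\<And>r. 0 < r \<Longrightarrow> scale (complex_of_real r) e + x \<in> pos"
  shows "x \<in> pos"
  using archimedean_unit assms
  unfolding archimedean_order_unit_def le_def
  by (auto simp: hermitian_zero hermitian_add hermitian_scale_real unit_hermitian)

lemma unit_pos: "e \<in> pos"
proof -
  obtain r where "0 < r" "scale (complex_of_real r) e \<in> pos"
    using unit_bounds[OF hermitian_zero] by auto
  then show ?thesis
    using pos_scale[of "1/r" "scale (complex_of_real r) e"] by simp
qed

lemma unit_nonzero:
  assumes "(UNIV :: 'a set) \<noteq> {0}"
  shows "e \<noteq> 0"
proof
  assume e: "e = 0"
  have nonpos: "- x \<in> pos" if "x \<in> hermitian" for x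
    using unit_bounds[OF that] e by auto
  have zero: "x = 0" if "x \<in> hermitian" for x
    using nonpos[OF that] nonpos[OF hermitian_minus[OF that]] pos_minus_imp_zero by simp
  have "v = 0" for v :: 'a
  proof -
    obtain y z where "y \<in> hermitian" "z \<in> hermitian" "v = y + scale \<i> z"
      by (rule hermitian_parts)
    then show ?thesis
      by (auto dest!: zero)
  qed
  with assms show False
    by auto
qed

lemma scale_unit_pos_iff:
  assumes "e \<noteq> 0"
  shows "scale c e \<in> pos \<longleftrightarrow> c \<in> \<real>\<^sub>\<ge>\<^sub>0"
proof
  assume pos: "scale c e \<in> pos"
  then have "scale (cnj c) e = scale c e"
    using pos_hermitian unit_hermitian star_scale[of c e] by (auto simp: hermitian_def)
  then have "c \<in> \<real>"
    using assms by (simp add: Reals_cnj_iff)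
  then obtain r where r: "c = complex_of_real r"
    by (auto elim: Reals_cases)
  have "0 \<le> r"
  proof (rule ccontr)
    assume "\<not> 0 \<le> r"
    then have "- scale c e \<in> pos"
      using pos_scale[OF _ unit_pos, of "- r"] r by simp
    with pos have "scale c e = 0"
      by (rule pos_minus_imp_zero)
    then show False
      using assms r \<open>\<not> 0 \<le> r\<close> by simp
  qed
  then show "c \<in> \<real>\<^sub>\<ge>\<^sub>0"
    using r by simp
next
  assume "c \<in> \<real>\<^sub>\<ge>\<^sub>0"
  then show "scale c e \<in> pos"
    using pos_scale[OF _ unit_pos] by (auto elim!: nonneg_Reals_cases)
qed

text \<open>The Archimedean property makes the infimum of the upper bounds of \<open>x\<close> an upper bound.\<close>

lemma upper_bound_threshold:
  assumes e: "e \<noteq> 0" and x: "x \<in> hermitian"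
  obtains b where "\<And>r. scale (complex_of_real r) e - x \<in> pos \<longleftrightarrow> b \<le> r"
proof -
  define B where "B = {r. scale (complex_of_real r) e - x \<in> pos}"
  define b where "b = Inf B"
  obtain s where s: "scale (complex_of_real s) e + x \<in> pos"
    using unit_bounds[OF hermitian_minus[OF x]] by auto
  have ne: "B \<noteq> {}"
    using unit_bounds[OF x] by (auto simp: B_def)
  have "- s \<le> r" if "r \<in> B" for r
  proof -
    have "(scale (complex_of_real r) e - x) + (scale (complex_of_real s) e + x) \<in> pos"
      using that s by (intro pos_add[of "_ - x"]) (auto simp: B_def)
    then have "scale (complex_of_real (r + s)) e \<in> pos"
      by (simp add: scale_left_distrib)
    then show ?thesis
      unfolding scale_unit_pos_iff[OF e] by (simp add: complex_nonneg_Reals_iff)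
  qed
  then have bdd: "bdd_below B"
    by (rule bdd_belowI)
  have up: "t \<in> B" if "r \<in> B" "r \<le> t" for r t
  proof -
    have "(scale (complex_of_real r) e - x) + scale (complex_of_real (t - r)) e \<in> pos"
      using that unit_pos by (intro pos_add pos_scale) (auto simp: B_def)
    then show ?thesis
      by (simp add: B_def scale_left_diff_distrib)
  qed
  have "scale (complex_of_real b) e - x \<in> pos"
  proof (rule archimedean)
    show "scale (complex_of_real b) e - x \<in> hermitian"
      by (intro hermitian_diff hermitian_scale_real unit_hermitian x)
    fix d :: real assume "0 < d"
    then obtain r where "r \<in> B" "r < b + d"
      using cInf_lessD[OF ne, of "b + d"] by (auto simp: b_def)
    then have "b + d \<in> B"
      using up by simp
    then show "scale (complex_of_real d) e + (scale (complex_of_real b) e - x) \<in> pos"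
      by (simp add: B_def scale_left_distrib algebra_simps)
  qed
  then have "r \<in> B \<longleftrightarrow> b \<le> r" for r
    using up[of b r] cInf_lower[OF _ bdd, of r] by (auto simp: B_def b_def)
  then show thesis
    using that by (simp add: B_def)
qed

lemma order_norm_le_iff:
  assumes e: "e \<noteq> 0" and w: "w \<in> hermitian"
  shows "order_norm w \<le> r \<longleftrightarrow>
    scale (complex_of_real r) e + w \<in> pos \<and> scale (complex_of_real r) e - w \<in> pos"
proof -
  obtain b where b: "\<And>r. scale (complex_of_real r) e - w \<in> pos \<longleftrightarrow> b \<le> r"
    using upper_bound_threshold[OF e w] by blast
  obtain b' where b': "\<And>r. scale (complex_of_real r) e - (- w) \<in> pos \<longleftrightarrow> b' \<le> r"
    using upper_bound_threshold[OF e hermitian_minus[OF w]] by blast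
  have "le 0 (scale (complex_of_real r) e + w) \<and> le 0 (scale (complex_of_real r) e - w)
      \<longleftrightarrow> max b b' \<le> r" for r
    using b[of r] b'[of r]
    by (auto simp: le_def hermitian_zero hermitian_add hermitian_diff hermitian_scale_real
        unit_hermitian w)
  then have "order_norm w = Inf {max b b'..}"
    unfolding order_norm_def by (simp add: atLeast_def)
  then show ?thesis
    using b[of r] b'[of r] by auto
qed

lemma order_norm_nonneg:
  assumes e: "e \<noteq> 0" and w: "w \<in> hermitian"
  shows "0 \<le> order_norm w"
proof -
  let ?r = "order_norm w"
  have "(scale (complex_of_real ?r) e + w) + (scale (complex_of_real ?r) e - w) \<in> pos"
    using order_norm_le_iff[OF e w, of ?r] by (intro pos_add[of "_ + w" "_ - w"]) auto
  then have "scale (complex_of_real (?r + ?r)) e \<in> pos"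
    by (simp only: of_real_add scale_left_distrib) simp
  then show ?thesis
    unfolding scale_unit_pos_iff[OF e] by (simp add: complex_nonneg_Reals_iff)
qed

lemma order_norm_unit_le:
  assumes e: "e \<noteq> 0"
  shows "order_norm e \<le> 1"
  using order_norm_le_iff[OF e unit_hermitian, of 1] unit_pos by (simp add: pos_add zero_in_pos)

lemma scale_le_order_norm:
  assumes e: "e \<noteq> 0" and w: "w \<in> hermitian"
  shows "scale (complex_of_real (\<bar>c\<bar> * order_norm w)) e - scale (complex_of_real c) w \<in> pos"
proof (cases "0 \<le> c")
  case True
  then have "scale (complex_of_real c) (scale (complex_of_real (order_norm w)) e - w) \<in> pos"
    using order_norm_le_iff[OF e w, of "order_norm w"] by (intro pos_scale) auto
  with True show ?thesis
    by (simp add: scale_right_diff_distrib)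
next
  case False
  then have "scale (complex_of_real (- c)) (scale (complex_of_real (order_norm w)) e + w) \<in> pos"
    using order_norm_le_iff[OF e w, of "order_norm w"] by (intro pos_scale) auto
  with False show ?thesis
    by (simp add: scale_right_distrib)
qed

lemma sum_scale_le_order_norm:
  assumes e: "e \<noteq> 0" and w: "\<And>i. i \<in> A \<Longrightarrow> w i \<in> hermitian"
  shows "scale (complex_of_real (\<Sum>i\<in>A. \<bar>c i\<bar> * order_norm (w i))) e
    - (\<Sum>i\<in>A. scale (complex_of_real (c i)) (w i)) \<in> pos"
proof -
  have "(\<Sum>i\<in>A. scale (complex_of_real (\<bar>c i\<bar> * order_norm (w i))) e
      - scale (complex_of_real (c i)) (w i)) \<in> pos"
    using w by (intro pos_sum scale_le_order_norm e)
  then show ?thesis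
    by (simp only: sum_subtractf of_real_sum scale_sum_left)
qed

section \<open>States and the two norms\<close>

lemma state_real_bound:
  assumes f: "state f" and "scale (complex_of_real r) e + y \<in> pos"
    "scale (complex_of_real r) e - y \<in> pos"
  shows "f y \<in> \<real>" "\<bar>Re (f y)\<bar> \<le> r"
proof -
  interpret Vector_Spaces.linear scale "(*)" f
    using f by (simp add: state_def)
  have "f e = 1" "f (scale (complex_of_real r) e + y) \<in> \<real>\<^sub>\<ge>\<^sub>0"
    "f (scale (complex_of_real r) e - y) \<in> \<real>\<^sub>\<ge>\<^sub>0"
    using assms by (auto simp: state_def)
  then have "complex_of_real r + f y \<in> \<real>\<^sub>\<ge>\<^sub>0" "complex_of_real r - f y \<in> \<real>\<^sub>\<ge>\<^sub>0"
    by (simp_all add: add diff scale)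
  then show "f y \<in> \<real>" "\<bar>Re (f y)\<bar> \<le> r"
    by (auto simp: complex_nonneg_Reals_iff complex_is_Real_iff)
qed

lemma state_le_order_norm:
  assumes e: "e \<noteq> 0" and f: "state f" and w: "w \<in> hermitian"
  shows "cmod (f w) \<le> order_norm w"
proof -
  have "f w \<in> \<real>" "\<bar>Re (f w)\<bar> \<le> order_norm w"
    using state_real_bound[OF f, of "order_norm w" w] order_norm_le_iff[OF e w, of "order_norm w"]
    by auto
  then show ?thesis
    by (simp add: in_Reals_norm)
qed

lemma max_order_norm_le:
  fixes l :: "nat \<Rightarrow> complex"
  assumes e: "e \<noteq> 0" and w: "\<And>i. i \<in> {1..n} \<Longrightarrow> w i \<in> hermitian"
    and v: "v = (\<Sum>i=1..n. scale (l i) (w i))"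
  shows "max_order_norm v \<le> (\<Sum>i=1..n. cmod (l i) * order_norm (w i))"
  unfolding max_order_norm_def
proof (rule cInf_lower)
  show "bdd_below {\<Sum>i=1..n. cmod (l i) * order_norm (w i)
      | (n::nat) (l :: nat \<Rightarrow> complex) (w :: nat \<Rightarrow> 'a).
      (\<forall>i\<in>{1..n}. w i \<in> hermitian) \<and> v = (\<Sum>i=1..n. scale (l i) (w i))}"
    by (rule bdd_belowI[of _ 0]) (auto intro!: sum_nonneg mult_nonneg_nonneg order_norm_nonneg e)
qed (use w v in blast)

lemma max_order_norm_ge:
  assumes "\<And>n (l :: nat \<Rightarrow> complex) w. (\<And>i. i \<in> {1..n} \<Longrightarrow> w i \<in> hermitian) \<Longrightarrow>
      v = (\<Sum>i=1..n. scale (l i) (w i)) \<Longrightarrow> C \<le> (\<Sum>i=1..n. cmod (l i) * order_norm (w i))"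
  shows "C \<le> max_order_norm v"
  unfolding max_order_norm_def
proof (rule cInf_greatest)
  obtain y z where yz: "y \<in> hermitian" "z \<in> hermitian" "v = y + scale \<i> z"
    by (rule hermitian_parts)
  define l where "l = (\<lambda>i::nat. if i = 1 then 1 else \<i>)"
  define w where "w = (\<lambda>i::nat. if i = 1 then y else z)"
  have "\<forall>i\<in>{1..2}. w i \<in> hermitian" "v = (\<Sum>i=1..2. scale (l i) (w i))"
    using yz by (auto simp: l_def w_def numeral_2_eq_2)
  then show "{\<Sum>i=1..n. cmod (l i) * order_norm (w i)
      | (n::nat) (l :: nat \<Rightarrow> complex) (w :: nat \<Rightarrow> 'a).
      (\<forall>i\<in>{1..n}. w i \<in> hermitian) \<and> v = (\<Sum>i=1..n. scale (l i) (w i))} \<noteq> {}"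
    by blast
qed (use assms in blast)

lemma max_order_norm_zero_le:
  assumes e: "e \<noteq> 0"
  shows "max_order_norm 0 \<le> 0"
  using max_order_norm_le[OF e, of 0 "\<lambda>_. 0" 0 "\<lambda>_. 0"] by simp

section \<open>Equality of the norms forces dimension one\<close>

text \<open>
  The hypotheses on \<open>h\<close> say that \<open>h e + y\<close> and \<open>h e - y\<close> both have order norm at least
  \<open>2 h\<close>: with \<open>- h e \<le> y \<le> h e\<close> this means that \<open>[- h, h]\<close> is the smallest interval
  that contains \<open>y\<close>.
\<close>

lemma max_order_norm_ge_double:
  assumes e: "e \<noteq> 0" and y: "y \<in> hermitian"
    and upper: "\<And>r. scale (complex_of_real r) e - (scale (complex_of_real h) e + y) \<in> pos
      \<Longrightarrow> 2 * h \<le> r"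
    and lower: "\<And>r. scale (complex_of_real r) e - (scale (complex_of_real h) e - y) \<in> pos
      \<Longrightarrow> 2 * h \<le> r"
  shows "2 * h \<le> max_order_norm (y + scale \<i> (scale (complex_of_real h) e))"
proof (rule max_order_norm_ge)
  fix n :: nat and l :: "nat \<Rightarrow> complex" and w
  assume w: "\<And>i. i \<in> {1..n} \<Longrightarrow> w i \<in> hermitian"
    and v: "y + scale \<i> (scale (complex_of_real h) e) = (\<Sum>i=1..n. scale (l i) (w i))"
  have parts: "y = (\<Sum>i=1..n. scale (complex_of_real (Re (l i))) (w i))"
    "scale (complex_of_real h) e = (\<Sum>i=1..n. scale (complex_of_real (Im (l i))) (w i))"
    by (rule hermitian_parts_sum[OF y hermitian_scale_real[OF unit_hermitian] w v]; assumption)+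
  have le: "scale (complex_of_real (\<Sum>i=1..n. \<bar>c i\<bar> * order_norm (w i))) e
      - (\<Sum>i=1..n. scale (complex_of_real (c i)) (w i)) \<in> pos" for c
    using w by (rule sum_scale_le_order_norm[OF e])
  have sum_eq: "scale (complex_of_real h) e + y
      = (\<Sum>i=1..n. scale (complex_of_real (Im (l i) + Re (l i))) (w i))"
    unfolding parts by (simp add: scale_left_distrib sum.distrib)
  have 1: "2 * h \<le> (\<Sum>i=1..n. \<bar>Im (l i) + Re (l i)\<bar> * order_norm (w i))"
    by (rule upper) (unfold sum_eq, rule le)
  have diff_eq: "scale (complex_of_real h) e - y
      = (\<Sum>i=1..n. scale (complex_of_real (Im (l i) - Re (l i))) (w i))"
    unfolding parts by (simp add: scale_left_diff_distrib sum_subtractf)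
  have 2: "2 * h \<le> (\<Sum>i=1..n. \<bar>Im (l i) - Re (l i)\<bar> * order_norm (w i))"
    by (rule lower) (unfold diff_eq, rule le)
  have "4 * h \<le> (\<Sum>i=1..n. (\<bar>Im (l i) + Re (l i)\<bar> + \<bar>Im (l i) - Re (l i)\<bar>) * order_norm (w i))"
    using 1 2 by (simp add: distrib_right sum.distrib)
  also have "\<dots> \<le> (\<Sum>i=1..n. 2 * cmod (l i) * order_norm (w i))"
  proof (intro sum_mono mult_right_mono)
    fix i assume "i \<in> {1..n}"
    then show "0 \<le> order_norm (w i)"
      using order_norm_nonneg[OF e w] by blast
    \<comment> \<open>The left-hand side is twice the larger of the two absolute values.\<close>
    show "\<bar>Im (l i) + Re (l i)\<bar> + \<bar>Im (l i) - Re (l i)\<bar> \<le> 2 * cmod (l i)"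
      using abs_Re_le_cmod[of "l i"] abs_Im_le_cmod[of "l i"] by linarith
  qed
  also have "\<dots> = 2 * (\<Sum>i=1..n. cmod (l i) * order_norm (w i))"
    by (simp add: sum_distrib_left mult.assoc)
  finally show "2 * h \<le> (\<Sum>i=1..n. cmod (l i) * order_norm (w i))"
    by simp
qed

lemma state_norm_le_sqrt2:
  assumes f: "state f" and y: "scale (complex_of_real h) e + y \<in> pos"
    "scale (complex_of_real h) e - y \<in> pos"
  shows "cmod (f (y + scale \<i> (scale (complex_of_real h) e))) \<le> sqrt 2 * h"
proof -
  interpret Vector_Spaces.linear scale "(*)" f
    using f by (simp add: state_def)
  have "f e = 1"
    using f by (simp add: state_def)
  then have fv: "f (y + scale \<i> (scale (complex_of_real h) e)) = f y + \<i> * complex_of_real h"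
    by (simp add: add scale)
  have real: "f y \<in> \<real>" and bound: "\<bar>Re (f y)\<bar> \<le> h"
    using state_real_bound[OF f y] by auto
  from bound have h: "0 \<le> h"
    by linarith
  have "(Re (f y))\<^sup>2 \<le> h\<^sup>2"
    using bound by (rule power2_le_iff_abs_le[THEN iffD2, rotated]) (rule h)
  then have "sqrt ((Re (f y))\<^sup>2 + h\<^sup>2) \<le> sqrt (2 * h\<^sup>2)"
    by simp
  also have "\<dots> = sqrt 2 * h"
    using h by (simp add: real_sqrt_mult)
  finally show ?thesis
    using real unfolding fv by (simp add: cmod_def complex_is_Real_iff)
qed

lemma min_eq_max_imp_hermitian_multiple:
  assumes e: "e \<noteq> 0" and eq: "min_order_norm = max_order_norm" and x: "x \<in> hermitian"
  obtains t where "x = scale (complex_of_real t) e"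
proof -
  obtain b where b: "\<And>r. scale (complex_of_real r) e - x \<in> pos \<longleftrightarrow> b \<le> r"
    using upper_bound_threshold[OF e x] by blast
  obtain a' where a': "\<And>r. scale (complex_of_real r) e - (- x) \<in> pos \<longleftrightarrow> a' \<le> r"
    using upper_bound_threshold[OF e hermitian_minus[OF x]] by blast
  define a where "a = - a'"
  define m where "m = (a + b) / 2"
  define h where "h = (b - a) / 2"
  define y where "y = x - scale (complex_of_real m) e"
  have y_herm: "y \<in> hermitian"
    unfolding y_def by (intro hermitian_diff hermitian_scale_real x unit_hermitian)
  have shift_up: "scale (complex_of_real r) e - y \<in> pos \<longleftrightarrow> h \<le> r" for r
  proof -
    have shift: "scale (complex_of_real r) e - y = scale (complex_of_real (r + m)) e - x"
      by (simp add: y_def scale_left_distrib algebra_simps)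
    show ?thesis
      unfolding shift b by (auto simp: m_def h_def field_simps)
  qed
  have shift_down: "scale (complex_of_real r) e + y \<in> pos \<longleftrightarrow> h \<le> r" for r
  proof -
    have shift: "scale (complex_of_real r) e + y = scale (complex_of_real (r - m)) e - (- x)"
      by (simp add: y_def scale_left_diff_distrib algebra_simps)
    show ?thesis
      unfolding shift a' by (auto simp: m_def h_def a_def field_simps)
  qed
  have "y = 0"
  proof (rule ccontr)
    assume "y \<noteq> 0"
    let ?v = "y + scale \<i> (scale (complex_of_real h) e)"
    have y: "scale (complex_of_real h) e + y \<in> pos" "scale (complex_of_real h) e - y \<in> pos"
      using shift_up shift_down by auto
    have "0 < h"
    proof (rule ccontr)
      assume "\<not> 0 < h"
      then have "y \<in> pos" "- y \<in> pos"
        using shift_down[of 0] shift_up[of 0] by auto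
      with \<open>y \<noteq> 0\<close> show False
        using pos_minus_imp_zero by blast
    qed
    have max: "2 * h \<le> max_order_norm ?v"
    proof (rule max_order_norm_ge_double[OF e y_herm])
      fix r
      show "2 * h \<le> r"
        if "scale (complex_of_real r) e - (scale (complex_of_real h) e + y) \<in> pos"
        using that shift_up[of "r - h"] by (simp add: scale_left_diff_distrib algebra_simps)
      show "2 * h \<le> r"
        if "scale (complex_of_real r) e - (scale (complex_of_real h) e - y) \<in> pos"
        using that shift_down[of "r - h"] by (simp add: scale_left_diff_distrib algebra_simps)
    qed
    show False
    proof (cases "\<exists>f. state f")
      case True
      then have "min_order_norm ?v \<le> sqrt 2 * h"
        unfolding min_order_norm_def
        using state_norm_le_sqrt2[OF _ y] by (intro cSup_least) auto
      with max eq have "2 * h \<le> sqrt 2 * h"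
        by simp
      then have "2 \<le> sqrt 2"
        using \<open>0 < h\<close> by simp
      then show False
        using sqrt2_less_2 by simp
    next
      case False
      \<comment> \<open>Both values are the supremum of the empty set.\<close>
      then have "min_order_norm ?v = min_order_norm 0"
        by (simp add: min_order_norm_def)
      with max eq have "2 * h \<le> 0"
        using max_order_norm_zero_le[OF e] by simp
      with \<open>0 < h\<close> show False
        by simp
    qed
  qed
  then have "x = scale (complex_of_real m) e"
    by (simp add: y_def)
  then show thesis
    by (rule that)
qed

lemma unital_order_isomorphism_if_min_eq_max:
  assumes e: "e \<noteq> 0" and eq: "min_order_norm = max_order_norm"
  shows "\<exists>\<phi>. unital_order_isomorphism scale pos e (*) \<real>\<^sub>\<ge>\<^sub>0 1 \<phi>"
proof -
  define \<psi> where "\<psi> = (\<lambda>c. scale c e)"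
  have "inj \<psi>"
    using e by (auto simp: inj_def \<psi>_def)
  moreover have "surj \<psi>"
  proof (rule surjI)
    fix v
    obtain y z where yz: "y \<in> hermitian" "z \<in> hermitian" "v = y + scale \<i> z"
      by (rule hermitian_parts)
    obtain s t where "y = scale (complex_of_real s) e" "z = scale (complex_of_real t) e"
      using min_eq_max_imp_hermitian_multiple[OF e eq] yz(1,2) by metis
    then have "v = \<psi> (complex_of_real s + \<i> * complex_of_real t)"
      using yz(3) by (simp add: \<psi>_def scale_left_distrib)
    then show "\<psi> (SOME c. \<psi> c = v) = v"
      by (metis (mono_tags, lifting) someI)
  qed
  ultimately have bij: "bij \<psi>"
    by (rule bijI)
  define \<phi> where "\<phi> = inv \<psi>"
  have \<psi>\<phi>: "scale (\<phi> v) e = v" for v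
    using surj_f_inv_f[OF \<open>surj \<psi>\<close>, of v] by (simp add: \<phi>_def \<psi>_def)
  have eqI: "c = d" if "scale c e = scale d e" for c d
    using that e by simp
  have "Vector_Spaces.linear scale (*) \<phi>"
  proof unfold_locales
    show "\<phi> (v + w) = \<phi> v + \<phi> w" for v w
      by (rule eqI) (simp add: \<psi>\<phi> scale_left_distrib)
    show "\<phi> (scale c v) = c * \<phi> v" for c v
      by (rule eqI) (simp add: \<psi>\<phi> flip: scale_scale)
  qed
  moreover have "bij \<phi>"
    unfolding \<phi>_def using bij by (rule bij_imp_bij_inv)
  moreover have "\<phi> e = 1"
    by (rule eqI) (simp add: \<psi>\<phi>)
  moreover have "v \<in> pos \<longleftrightarrow> \<phi> v \<in> \<real>\<^sub>\<ge>\<^sub>0" for v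
    using scale_unit_pos_iff[OF e, of "\<phi> v"] by (simp add: \<psi>\<phi>)
  ultimately show ?thesis
    unfolding unital_order_isomorphism_def by blast
qed

section \<open>Equality of the norms in dimension one\<close>

lemma min_eq_max_if_unital_order_isomorphism:
  assumes e: "e \<noteq> 0" and \<phi>: "unital_order_isomorphism scale pos e (*) \<real>\<^sub>\<ge>\<^sub>0 1 \<phi>"
  shows "min_order_norm = max_order_norm"
proof
  fix v
  interpret \<phi>: Vector_Spaces.linear scale "(*)" \<phi>
    using \<phi> by (simp add: unital_order_isomorphism_def)
  have "\<phi> e = 1" "inj \<phi>"
    using \<phi> by (auto simp: unital_order_isomorphism_def bij_is_inj)
  have multiple: "v = scale (\<phi> v) e" for v
    using \<open>inj \<phi>\<close> by (rule injD) (simp add: \<phi>.scale \<open>\<phi> e = 1\<close>)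
  have state: "state \<phi>"
    using \<phi> by (auto simp: state_def unital_order_isomorphism_def)
  have unique: "f v = \<phi> v" if "state f" for f
  proof -
    interpret f: Vector_Spaces.linear scale "(*)" f
      using that by (simp add: state_def)
    have "f (scale (\<phi> v) e) = \<phi> v"
      using that by (simp add: f.scale state_def)
    then show ?thesis
      using multiple by metis
  qed
  have min: "min_order_norm v = cmod (\<phi> v)"
    unfolding min_order_norm_def
  proof (rule cSup_eq_maximum)
    show "cmod (\<phi> v) \<in> {cmod (f v) | f. state f}"
      using state by blast
    show "r \<le> cmod (\<phi> v)" if "r \<in> {cmod (f v) | f. state f}" for r
      using that by (auto dest: unique)
  qed
  have "max_order_norm v \<le> cmod (\<phi> v) * order_norm e"
    using max_order_norm_le[OF e, of 1 "\<lambda>_. e" v "\<lambda>_. \<phi> v"] unit_hermitian multiple[of v]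
    by simp
  also have "\<dots> \<le> cmod (\<phi> v)"
    using order_norm_unit_le[OF e] by (simp add: mult_left_le)
  finally have le: "max_order_norm v \<le> cmod (\<phi> v)" .
  have ge: "cmod (\<phi> v) \<le> max_order_norm v"
  proof (rule max_order_norm_ge)
    fix n :: nat and l :: "nat \<Rightarrow> complex" and w
    assume w: "\<And>i. i \<in> {1..n} \<Longrightarrow> w i \<in> hermitian" and v: "v = (\<Sum>i=1..n. scale (l i) (w i))"
    have "cmod (\<phi> v) \<le> (\<Sum>i=1..n. cmod (l i * \<phi> (w i)))"
      unfolding v by (simp add: \<phi>.sum \<phi>.scale norm_sum)
    also have "\<dots> \<le> (\<Sum>i=1..n. cmod (l i) * order_norm (w i))"
      using w by (intro sum_mono)
        (simp add: norm_mult mult_left_mono state_le_order_norm[OF e state])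
    finally show "cmod (\<phi> v) \<le> (\<Sum>i=1..n. cmod (l i) * order_norm (w i))" .
  qed
  show "min_order_norm v = max_order_norm v"
    using min le ge by simp
qed

end

section \<open>The characterization of the complex numbers\<close>

theorem theorem5p13:
  fixes scale :: "complex \<Rightarrow> 'a::ab_group_add \<Rightarrow> 'a"
    and star :: "'a \<Rightarrow> 'a"
    and pos :: "'a set"
    and e :: 'a
  assumes V: "archimedean_ordered_star_vector_space scale star pos e"
    and nonzero: "(UNIV :: 'a set) \<noteq> {0}"
  shows "archimedean_ordered_star_vector_space.min_order_norm scale pos e =
      archimedean_ordered_star_vector_space.max_order_norm scale star pos e \<longleftrightarrow>
    (\<exists>\<phi> :: 'a \<Rightarrow> complex. unital_order_isomorphism scale pos e (*) \<real>\<^sub>\<ge>\<^sub>0 1 \<phi>)"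
proof -
  interpret archimedean_ordered_star_vector_space scale star pos e
    by (rule V)
  have "e \<noteq> 0"
    using nonzero by (rule unit_nonzero)
  then show ?thesis
    using unital_order_isomorphism_if_min_eq_max min_eq_max_if_unital_order_isomorphism by blast
qed

end
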